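(* For every $q\in\mathbb{C}$ with $|q|\leq 0.108$, $q$ is not a spectral value of the partial theta function $\theta$; that is, the entire function $x\mapsto\theta(q,x)=\sum_{j=0}^{\infty}q^{j(j+1)/2}x^j$ ($x\in\mathbb{C}$) has no multiple zero in $\mathbb{C}$.
   Context: For $q\in\mathbb{C}$ with $|q|<1$, the partial theta function is $\theta(q,x):=\sum_{j=0}^{\infty}q^{j(j+1)/2}x^j$, an entire function of the complex variable $x$ for each fixed $q$ (with $\theta(0,\cdot)\equiv 1$). A value of $q$ is called a spectral value of $\theta$ (belongs to the spectrum of $\theta$) if $\theta(q,\cdot)$ has a multiple zero, i.e. a zero of multiplicity at least $2$. *)

theory Defs
  imports "HOL-Complex_Analysis.Complex_Analysis"
begin

text \<open>The exponent \<open>j * (j + 1) div 2\<close> is an exact division. The series converges for every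
  \<open>x\<close> when \<open>norm q < 1\<close>, the only range in which this function is meaningful; at \<open>q = 0\<close> the
  convention \<open>0 ^ 0 = 1\<close> makes it constantly \<open>1\<close>.\<close>

definition partial_theta :: "complex \<Rightarrow> complex \<Rightarrow> complex" where
  "partial_theta q x = (\<Sum>j. q ^ (j * (j + 1) div 2) * x ^ j)"

text \<open>The order \<open>zorder f a\<close> is the multiplicity of the zero only if \<open>f\<close> is holomorphic near \<open>a\<close>
  and not identically zero there. Both hold for \<open>partial_theta q\<close> with \<open>norm q < 1\<close>, which is
  entire with value \<open>1\<close> at the origin.\<close>

definition multiple_zero :: "(complex \<Rightarrow> complex) \<Rightarrow> complex \<Rightarrow> bool" where
  "multiple_zero f a \<longleftrightarrow> f a = 0 \<and> zorder f a \<ge> 2"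

definition spectral_value :: "complex \<Rightarrow> bool" where
  "spectral_value q \<longleftrightarrow> norm q < 1 \<and> (\<exists>a. multiple_zero (partial_theta q) a)"

end

theory Submission
  imports Defs
begin

text \<open>Put \<open>r = \<bar>q\<bar>\<close> and \<open>s = \<surd>r\<close>, and let \<open>t j\<close> be the \<open>j\<close>-th term of the series at \<open>a\<close>. The ratios
  \<open>\<rho> j = \<bar>t j\<bar> / \<bar>t (j - 1)\<bar> = r ^ j * \<bar>a\<bar>\<close> decrease geometrically. If \<open>\<rho> 1 \<le> s\<close>, the term \<open>t 0 = 1\<close>
  dominates the sum of all others and \<open>a\<close> is not a zero. Otherwise let \<open>k\<close> be the last index with
  \<open>\<rho> k \<ge> s\<close>, so that \<open>t k\<close> and \<open>t (k - 1)\<close> are the two largest terms. At a multiple zero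
  \<open>(\<Sum>j. (j - c) * t j) = 0\<close> for every \<open>c\<close>; taking for \<open>c\<close> the index of the smaller of the two
  removes that term, and the larger one then exceeds the sum of all the rest, because
  \<open>2 s + 3 s\<^sup>4 + \<dots> + s\<^sup>2 + 2 s\<^sup>6 + \<dots> < 1\<close>.\<close>

section \<open>Terms of the series and their ratios\<close>

definition theta_term :: "complex \<Rightarrow> complex \<Rightarrow> nat \<Rightarrow> complex" where
  "theta_term q x j = q ^ (j * (j + 1) div 2) * x ^ j"

lemma theta_term_0 [simp]: "theta_term q x 0 = 1"
  by (simp add: theta_term_def)

lemma theta_term_Suc: "theta_term q x (Suc j) = q ^ Suc j * x * theta_term q x j"
proof -
  have "Suc j * (Suc j + 1) div 2 = Suc j + j * (j + 1) div 2"
  proof -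
    have "Suc j * (Suc j + 1) = j * (j + 1) + Suc j * 2"
      by (simp add: algebra_simps)
    then show ?thesis
      by (metis add.commute div_mult_self3 zero_neq_numeral)
  qed
  then show ?thesis
    by (simp add: theta_term_def power_add)
qed

lemma theta_term_nonzero: "q \<noteq> 0 \<Longrightarrow> x \<noteq> 0 \<Longrightarrow> theta_term q x j \<noteq> 0"
  by (simp add: theta_term_def)

lemma norm_theta_term_Suc:
  "norm (theta_term q x (Suc j)) = norm q ^ Suc j * norm x * norm (theta_term q x j)"
  by (simp add: theta_term_Suc norm_mult norm_power)

lemma summable_theta_term:
  assumes "norm q < 1"
  shows "summable (theta_term q x)"
proof -
  have "(\<lambda>n. norm q ^ Suc n * norm x) \<longlonglongrightarrow> 0 * norm x"
    using assms by (intro tendsto_intros LIMSEQ_Suc LIMSEQ_realpow_zero) auto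
  then have "eventually (\<lambda>n. norm q ^ Suc n * norm x < 1/2) sequentially"
    using order_tendstoD(2)[of _ 0 _ "1/2 :: real"] by simp
  then obtain N where N: "\<And>n. n \<ge> N \<Longrightarrow> norm q ^ Suc n * norm x < 1/2"
    by (auto simp: eventually_sequentially)
  show ?thesis
  proof (rule summable_ratio_test[where c = "1/2" and N = N])
    fix n assume "n \<ge> N"
    then show "norm (theta_term q x (Suc n)) \<le> 1/2 * norm (theta_term q x n)"
      unfolding norm_theta_term_Suc by (intro mult_right_mono less_imp_le[OF N] norm_ge_zero)
  qed simp
qed

section \<open>Termwise differentiation and the equations at a multiple zero\<close>

lemma partial_theta_derivative:
  assumes "norm q < 1"
  obtains D where "(partial_theta q has_field_derivative D) (at x)"
    and "(\<lambda>j. of_nat j * theta_term q x j) sums (x * D)"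
proof -
  define c where "c = (\<lambda>j. q ^ (j * (j + 1) div 2))"
  have summ: "summable (\<lambda>n. c n * y ^ n)" for y
    using summable_theta_term[OF assms, of y] unfolding theta_term_def[abs_def] c_def .
  define D where "D = (\<Sum>n. diffs c n * x ^ n)"
  have "((\<lambda>y. \<Sum>n. c n * y ^ n) has_field_derivative D) (at x)"
    unfolding D_def by (rule termdiffs_strong_converges_everywhere[OF summ])
  then have 1: "(partial_theta q has_field_derivative D) (at x)"
    by (simp add: partial_theta_def[abs_def] c_def)
  have "(\<lambda>n. of_nat n * c n * x ^ (n - Suc 0)) sums D"
    unfolding D_def by (intro diffs_equiv termdiff_converges_all summ)
  \<comment> \<open>Multiplying the derivative by \<open>x\<close> restores the original terms with
    weight \<open>j\<close>, so no index shift is needed.\<close>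
  then have "(\<lambda>n. x * (of_nat n * c n * x ^ (n - Suc 0))) sums (x * D)"
    by (rule sums_mult)
  also have "(\<lambda>n. x * (of_nat n * c n * x ^ (n - Suc 0))) = (\<lambda>j. of_nat j * theta_term q x j)"
  proof
    fix n show "x * (of_nat n * c n * x ^ (n - Suc 0)) = of_nat n * theta_term q x n"
      by (cases n) (simp_all add: theta_term_def c_def)
  qed
  finally show ?thesis using 1 that by blast
qed

text \<open>A zero with nonvanishing derivative is isolated and has order exactly 1. Arguing by
  contradiction also excludes an identically zero \<open>f\<close>.\<close>

lemma multiple_zero_deriv_eq_0:
  assumes "f holomorphic_on UNIV" "multiple_zero f a"
  shows "deriv f a = 0"
proof (rule ccontr)
  assume "deriv f a \<noteq> 0"
  moreover have "f a = 0" and ord: "zorder f a \<ge> 2"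
    using assms(2) by (auto simp: multiple_zero_def)
  ultimately have "zorder f a = int 1"
    using assms(1) by (intro zorder_zero_eqI[of f UNIV]) auto
  with ord show False by simp
qed

lemma multiple_zero_partial_theta_sums:
  assumes "norm q < 1" "multiple_zero (partial_theta q) a"
  shows "theta_term q a sums 0"
    and "(\<lambda>j. (of_nat j - c) * theta_term q a j) sums 0"
proof -
  have "partial_theta q a = 0"
    using assms(2) by (simp add: multiple_zero_def)
  with summable_sums[OF summable_theta_term[OF assms(1), of a]]
  show 1: "theta_term q a sums 0"
    by (simp add: partial_theta_def theta_term_def[abs_def])
  have "partial_theta q holomorphic_on UNIV"
    by (meson assms(1) field_differentiable_def holomorphic_on_def field_differentiable_at_within
        partial_theta_derivative)
  then have "deriv (partial_theta q) a = 0"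
    using assms(2) by (rule multiple_zero_deriv_eq_0)
  moreover obtain D where "(partial_theta q has_field_derivative D) (at a)"
    and D: "(\<lambda>j. of_nat j * theta_term q a j) sums (a * D)"
    using partial_theta_derivative[OF assms(1)] by blast
  ultimately have "D = 0"
    by (simp add: DERIV_imp_deriv)
  then show "(\<lambda>j. (of_nat j - c) * theta_term q a j) sums 0"
    using sums_diff[OF D sums_mult[OF 1, of c]] by (simp add: algebra_simps)
qed

section \<open>Decay of the terms on both sides of the dominant pair\<close>

lemma super_geometric_decay:
  fixes y :: "nat \<Rightarrow> real"
  assumes "0 \<le> s" and "\<And>m. m < n \<Longrightarrow> y (Suc m) \<le> s ^ (2 * m + Suc e) * y m" and "m \<le> n"
  shows "y m \<le> s ^ (m * (m + e)) * y 0"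
  using assms(3)
proof (induction m)
  case (Suc m)
  have "y (Suc m) \<le> s ^ (2 * m + Suc e) * y m"
    using Suc.prems by (intro assms(2)) simp
  also have "\<dots> \<le> s ^ (2 * m + Suc e) * (s ^ (m * (m + e)) * y 0)"
    using Suc assms(1) by (intro mult_left_mono) auto
  also have "\<dots> = s ^ (2 * m + Suc e + m * (m + e)) * y 0"
    by (simp add: power_add)
  \<comment> \<open>The odd (\<open>e = 0\<close>) or even (\<open>e = 1\<close>) step exponents
    \<open>2 * i + 1 + e\<close> add up to the square \<open>m * m\<close> or the pronic number
    \<open>m * (m + 1)\<close>.\<close>
  also have "2 * m + Suc e + m * (m + e) = Suc m * (Suc m + e)"
    by (simp add: algebra_simps)
  finally show ?case .
qed simp

text \<open>Each further ratio gains a factor \<open>s\<^sup>2\<close>, so a bound on the first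
  ratio beyond \<open>k\<close> suffices: \<open>s\<close> for \<open>e = 0\<close>,
  \<open>s\<^sup>2\<close> for \<open>e = 1\<close>.\<close>

lemma norm_theta_term_up:
  assumes "0 \<le> s" "norm q = s\<^sup>2" "norm q ^ Suc k * norm a \<le> s ^ Suc e"
  shows "norm (theta_term q a (k + m)) \<le> s ^ (m * (m + e)) * norm (theta_term q a k)"
proof -
  have "norm (theta_term q a (k + Suc i)) \<le> s ^ (2 * i + Suc e) * norm (theta_term q a (k + i))" for i
  proof -
    have "norm q ^ Suc (k + i) * norm a = s ^ (2 * i) * (norm q ^ Suc k * norm a)"
      by (simp add: assms(2) power_add power_mult)
    also have "\<dots> \<le> s ^ (2 * i) * s ^ Suc e"
      using assms by (intro mult_left_mono) auto
    finally have "norm q ^ Suc (k + i) * norm a \<le> s ^ (2 * i + Suc e)"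
      by (simp add: power_add mult_ac)
    then show ?thesis
      by (simp only: add_Suc_right norm_theta_term_Suc mult_right_mono norm_ge_zero)
  qed
  from super_geometric_decay[OF assms(1), of m "\<lambda>i. norm (theta_term q a (k + i))", OF this]
  show ?thesis by simp
qed

text \<open>Going down, the reciprocal ratios shrink by \<open>s\<^sup>2\<close> per step. The
  hypothesis says that \<rho> (p + 1) is at least \<open>s\<close> for \<open>e = 0\<close> and at
  least 1 for \<open>e = 1\<close>; the factor \<open>s ^ e\<close> avoids a negative
  exponent.\<close>

lemma norm_theta_term_down:
  assumes "0 < s" "norm q = s\<^sup>2" "s \<le> s ^ e * (norm q ^ Suc p * norm a)" "m \<le> p"
  shows "norm (theta_term q a (p - m)) \<le> s ^ (m * (m + e)) * norm (theta_term q a p)"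
proof -
  have "norm (theta_term q a (p - Suc i)) \<le> s ^ (2 * i + Suc e) * norm (theta_term q a (p - i))"
    if "i < p" for i
  proof -
    define j where "j = p - Suc i"
    have j: "p - i = Suc j" "p = Suc (j + i)"
      using that by (auto simp: j_def)
    have "s * norm (theta_term q a j) \<le> s ^ e * (norm q ^ Suc p * norm a) * norm (theta_term q a j)"
      using assms(3) by (intro mult_right_mono) auto
    also have "\<dots> = s ^ e * norm q ^ Suc i * norm (theta_term q a (Suc j))"
      by (simp add: norm_theta_term_Suc j(2) power_add)
    also have "s ^ e * norm q ^ Suc i = s * s ^ (2 * i + Suc e)"
      by (simp add: assms(2) power_add power_mult power2_eq_square power_mult_distrib)
    finally show ?thesis
      using assms(1) unfolding j(1) j_def[symmetric] by (simp only: mult.assoc mult_le_cancel_left_pos)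
  qed
  from super_geometric_decay[of s p "\<lambda>i. norm (theta_term q a (p - i))", OF _ this assms(4)]
  show ?thesis using assms(1) by simp
qed

section \<open>Geometric bounds for the weighted powers of \<open>s\<close>\<close>

lemma square_weight_le:
  fixes s :: real
  assumes "0 \<le> s" "s \<le> 0.33"
  shows "real (m + 2) * s ^ (Suc m * (Suc m + 0)) \<le> 0.66 * 0.06 ^ m"
proof (induction m)
  case (Suc m)
  \<comment> \<open>Consecutive weights have ratio at most \<open>3/2 * 0.33 ^ 3\<close>, and
    \<open>3/2 * 0.04 = 0.06\<close>.\<close>
  have "s ^ (2 * m + 3) \<le> s ^ 3"
    using assms by (intro power_decreasing) auto
  also have "\<dots> \<le> 0.33 ^ 3"
    using assms by (intro power_mono)
  also have "\<dots> \<le> 0.04"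
    by (simp add: power3_eq_cube)
  finally have "real (Suc m + 2) * s ^ (2 * m + 3) \<le> real (Suc m + 2) * 0.04"
    by (intro mult_left_mono) auto
  also have "\<dots> \<le> 0.06 * real (m + 2)"
    by simp
  finally have *: "real (Suc m + 2) * s ^ (2 * m + 3) \<le> 0.06 * real (m + 2)" .
  have "Suc (Suc m) * (Suc (Suc m) + 0) = 2 * m + 3 + Suc m * (Suc m + 0)"
    by (simp add: algebra_simps)
  then have "real (Suc m + 2) * s ^ (Suc (Suc m) * (Suc (Suc m) + 0))
      = real (Suc m + 2) * s ^ (2 * m + 3) * s ^ (Suc m * (Suc m + 0))"
    by (simp only: power_add mult.assoc)
  also have "\<dots> \<le> 0.06 * real (m + 2) * s ^ (Suc m * (Suc m + 0))"
    using * assms by (intro mult_right_mono) auto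
  also have "\<dots> \<le> 0.06 * (0.66 * 0.06 ^ m)"
    unfolding mult.assoc by (intro mult_left_mono Suc) simp
  also have "\<dots> = 0.66 * 0.06 ^ Suc m"
    by simp
  finally show ?case .
qed (use assms in simp)

lemma pronic_weight_le:
  fixes s :: real
  assumes "0 \<le> s" "s \<le> 0.33"
  shows "real (m + 1) * s ^ (Suc m * (Suc m + 1)) \<le> 0.11 * 0.06 ^ m"
proof (induction m)
  case 0
  have "s ^ 2 \<le> 0.33 ^ 2"
    using assms by (intro power_mono)
  then show ?case by (simp add: power2_eq_square)
next
  case (Suc m)
  \<comment> \<open>Here the ratio of consecutive weights is at most \<open>2 * 0.33 ^ 4\<close>,
    and \<open>2 * 0.03 = 0.06\<close>.\<close>
  have "s ^ (2 * m + 4) \<le> s ^ 4"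
    using assms by (intro power_decreasing) auto
  also have "\<dots> \<le> 0.33 ^ 4"
    using assms by (intro power_mono)
  also have "\<dots> \<le> 0.03"
    by (simp add: power4_eq_xxxx)
  finally have "real (Suc m + 1) * s ^ (2 * m + 4) \<le> real (Suc m + 1) * 0.03"
    by (intro mult_left_mono) auto
  also have "\<dots> \<le> 0.06 * real (m + 1)"
    by simp
  finally have *: "real (Suc m + 1) * s ^ (2 * m + 4) \<le> 0.06 * real (m + 1)" .
  have "Suc (Suc m) * (Suc (Suc m) + 1) = 2 * m + 4 + Suc m * (Suc m + 1)"
    by (simp add: algebra_simps)
  then have "real (Suc m + 1) * s ^ (Suc (Suc m) * (Suc (Suc m) + 1))
      = real (Suc m + 1) * s ^ (2 * m + 4) * s ^ (Suc m * (Suc m + 1))"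
    by (simp only: power_add mult.assoc)
  also have "\<dots> \<le> 0.06 * real (m + 1) * s ^ (Suc m * (Suc m + 1))"
    using * assms by (intro mult_right_mono) auto
  also have "\<dots> \<le> 0.06 * (0.11 * 0.06 ^ m)"
    unfolding mult.assoc by (intro mult_left_mono Suc) simp
  also have "\<dots> = 0.11 * 0.06 ^ Suc m"
    by simp
  finally show ?case .
qed

section \<open>Series with sum zero and geometric bounds\<close>

lemma norm_head_le_geometric_tail:
  fixes g :: "nat \<Rightarrow> 'a::banach"
  assumes "g sums 0" "0 \<le> x" "x < 1" "\<And>i. norm (g (i + n)) \<le> B * x ^ i"
  shows "norm (\<Sum>j<n. g j) \<le> B / (1 - x)"
proof -
  have geo: "(\<lambda>i. B * x ^ i) sums (B * (1 / (1 - x)))"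
    using assms by (intro sums_mult geometric_sums) auto
  have "norm (\<Sum>i. g (i + n)) \<le> (\<Sum>i. B * x ^ i)"
    using assms(4) sums_summable[OF geo] by (rule norm_suminf_le)
  moreover have "(\<Sum>i. g (i + n)) = - (\<Sum>j<n. g j)"
    using sums_iff_shift'[of g n 0] assms(1) by (simp add: sums_iff)
  ultimately show ?thesis
    using geo by (simp add: sums_iff)
qed

text \<open>The two terms are the head through \<open>p + 1\<close>, which is minus the upper tail,
  less the finitely many terms below \<open>p\<close>. Each part is bounded by a full geometric
  series.\<close>

lemma norm_two_terms_le_geometric:
  fixes g :: "nat \<Rightarrow> 'a::banach"
  assumes "g sums 0" "0 \<le> x" "x < 1" "0 \<le> A"
    and up: "\<And>i. norm (g (Suc p + Suc i)) \<le> B * x ^ i"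
    and down: "\<And>i. i < p \<Longrightarrow> norm (g (p - Suc i)) \<le> A * x ^ i"
  shows "norm (g p + g (Suc p)) \<le> (A + B) / (1 - x)"
proof -
  have "norm (\<Sum>j<Suc (Suc p). g j) \<le> B / (1 - x)"
    using up by (intro norm_head_le_geometric_tail assms(1-3)) (simp add: add_ac)
  moreover have "norm (\<Sum>j<p. g j) \<le> A / (1 - x)"
  proof -
    have "(\<Sum>j<p. g j) = (\<Sum>i<p. g (p - Suc i))"
      by (rule sum.nat_diff_reindex[symmetric])
    also have "norm \<dots> \<le> (\<Sum>i<p. A * x ^ i)"
      using down by (intro sum_norm_le) auto
    also have "\<dots> \<le> (\<Sum>i. A * x ^ i)"
      using assms by (intro sum_le_suminf summable_mult summable_geometric) auto
    also have "\<dots> = A / (1 - x)"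
      using assms by (simp add: suminf_mult suminf_geometric summable_geometric)
    finally show ?thesis .
  qed
  moreover have "norm (g p + g (Suc p)) \<le> norm (\<Sum>j<Suc (Suc p). g j) + norm (\<Sum>j<p. g j)"
  proof -
    have "g p + g (Suc p) = (\<Sum>j<Suc (Suc p). g j) - (\<Sum>j<p. g j)"
      by simp
    then show ?thesis by (metis norm_triangle_ineq4)
  qed
  ultimately show ?thesis
    by (simp add: add_divide_distrib)
qed

section \<open>Exclusion of multiple zeros\<close>

lemma no_zero_if_first_ratio_small:
  assumes "0 \<le> s" "s \<le> 0.33" "norm q = s\<^sup>2" "norm q * norm a \<le> s"
  shows "\<not> theta_term q a sums 0"
proof
  assume "theta_term q a sums 0"
  moreover have "norm (theta_term q a (i + 1)) \<le> 0.66 * 0.06 ^ i" for i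
  proof -
    have "norm (theta_term q a (0 + Suc i)) \<le> s ^ (Suc i * (Suc i + 0)) * norm (theta_term q a 0)"
      using assms by (intro norm_theta_term_up) auto
    also have "\<dots> \<le> real (i + 2) * s ^ (Suc i * (Suc i + 0))"
      using mult_right_mono[of 1 "real (i + 2)" "s ^ (Suc i * (Suc i + 0))"] assms(1) by simp
    also have "\<dots> \<le> 0.66 * 0.06 ^ i"
      by (rule square_weight_le[OF assms(1,2)])
    finally show ?thesis by simp
  qed
  ultimately have "norm (\<Sum>j<1. theta_term q a j) \<le> 0.66 / (1 - 0.06)"
    by (intro norm_head_le_geometric_tail) auto
  then show False by simp
qed

text \<open>The hypotheses place \<open>s\<close> between \<rho> (p + 2) and \<rho> (p + 1).
  Comparing \<rho> (p + 1) with 1 tells which of the terms \<open>p\<close> and \<open>p + 1\<close>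
  to remove. On the far side of the surviving term the distances to the removed index start at 2 and
  the decay is square; on the other side they start at 1 and the decay is pronic.\<close>

lemma not_multiple_zero_between:
  assumes s: "0 < s" "s \<le> 0.33" "norm q = s\<^sup>2" and "a \<noteq> 0"
    and lo: "s \<le> norm q ^ Suc p * norm a" and hi: "norm q ^ Suc (Suc p) * norm a \<le> s"
    and sums0: "\<And>c. (\<lambda>j. (of_nat j - c) * theta_term q a j) sums 0"
  shows False
proof -
  let ?t = "\<lambda>j. norm (theta_term q a j)"
  have "q \<noteq> 0" using s by auto
  with \<open>a \<noteq> 0\<close> have pos: "?t j > 0" for j
    by (simp add: theta_term_nonzero)
  have ratio: "?t (Suc p) = norm q ^ Suc p * norm a * ?t p"
    by (rule norm_theta_term_Suc)
  have dist: "norm (of_nat m - of_nat n :: complex) = real (m - n)"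
    "norm (of_nat n - of_nat m :: complex) = real (m - n)" if "n \<le> m" for m n
  proof -
    show "norm (of_nat m - of_nat n :: complex) = real (m - n)"
      using that by (metis norm_of_nat of_nat_diff)
    then show "norm (of_nat n - of_nat m :: complex) = real (m - n)"
      by (simp add: norm_minus_commute)
  qed
  show False
  proof (cases "norm q ^ Suc p * norm a \<ge> 1")
    case True
    let ?k = "Suc p"
    let ?g = "\<lambda>j. (of_nat j - of_nat p) * theta_term q a j"
    have le: "?t p \<le> ?t ?k"
      unfolding ratio using True pos[of p] by (simp add: mult_le_cancel_right1)
    have "norm (?g p + ?g ?k) \<le> (0.11 * ?t ?k + 0.66 * ?t ?k) / (1 - 0.06)"
    proof (rule norm_two_terms_le_geometric[OF sums0])
      fix i
      have "norm (?g (?k + Suc i)) = real (i + 2) * ?t (?k + Suc i)"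
        by (simp only: norm_mult dist) simp
      also have "\<dots> \<le> real (i + 2) * (s ^ (Suc i * (Suc i + 0)) * ?t ?k)"
        using s hi by (intro mult_left_mono norm_theta_term_up) auto
      also have "\<dots> \<le> 0.66 * 0.06 ^ i * ?t ?k"
        unfolding mult.assoc[symmetric] using s
        by (intro mult_right_mono square_weight_le) auto
      finally show "norm (?g (?k + Suc i)) \<le> 0.66 * ?t ?k * 0.06 ^ i"
        by (simp add: mult_ac)
    next
      fix i assume i: "i < p"
      then have "norm (?g (p - Suc i)) = real (i + 1) * ?t (p - Suc i)"
        by (subst norm_mult, subst dist) auto
      also have "\<dots> \<le> real (i + 1) * (s ^ (Suc i * (Suc i + 1)) * ?t p)"
        using s True i by (intro mult_left_mono norm_theta_term_down) auto
      also have "\<dots> \<le> 0.11 * 0.06 ^ i * ?t p"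
        unfolding mult.assoc[symmetric] using s
        by (intro mult_right_mono pronic_weight_le) auto
      also have "\<dots> \<le> 0.11 * 0.06 ^ i * ?t ?k"
        using le by (intro mult_left_mono) auto
      finally show "norm (?g (p - Suc i)) \<le> 0.11 * ?t ?k * 0.06 ^ i"
        by (simp add: mult_ac)
    qed auto
    \<comment> \<open>The left side is exactly \<open>?t ?k\<close>, since the term at
      \<open>p\<close> has weight 0 and that at \<open>p + 1\<close> has weight 1; but
      \<open>0.77 / 0.94 < 1\<close>.\<close>
    then show False using pos[of ?k] by simp
  next
    case False
    let ?k = "Suc p"
    let ?g = "\<lambda>j. (of_nat j - of_nat ?k) * theta_term q a j"
    have le: "?t ?k \<le> ?t p"
      unfolding ratio using False pos[of p] by (simp add: mult_le_cancel_right2)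
    \<comment> \<open>As \<rho> (p + 1) is below 1, the next ratio is at most
      \<open>s\<^sup>2\<close>, which gives the pronic decay upwards.\<close>
    have hi': "norm q ^ Suc ?k * norm a \<le> s ^ Suc 1"
    proof -
      have "norm q ^ Suc ?k * norm a = s\<^sup>2 * (norm q ^ Suc p * norm a)"
        using s(3) by simp
      also have "\<dots> \<le> s\<^sup>2 * 1"
        using False by (intro mult_left_mono) auto
      finally show ?thesis by (simp add: numeral_2_eq_2)
    qed
    have "norm (?g p + ?g ?k) \<le> (0.66 * ?t p + 0.11 * ?t p) / (1 - 0.06)"
    proof (rule norm_two_terms_le_geometric[OF sums0])
      fix i
      have "norm (?g (?k + Suc i)) = real (i + 1) * ?t (?k + Suc i)"
        by (subst norm_mult, subst dist) auto
      also have "\<dots> \<le> real (i + 1) * (s ^ (Suc i * (Suc i + 1)) * ?t ?k)"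
        using s hi' by (intro mult_left_mono norm_theta_term_up) auto
      also have "\<dots> \<le> 0.11 * 0.06 ^ i * ?t ?k"
        unfolding mult.assoc[symmetric] using s
        by (intro mult_right_mono pronic_weight_le) auto
      also have "\<dots> \<le> 0.11 * 0.06 ^ i * ?t p"
        using le by (intro mult_left_mono) auto
      finally show "norm (?g (?k + Suc i)) \<le> 0.11 * ?t p * 0.06 ^ i"
        by (simp add: mult_ac)
    next
      fix i assume i: "i < p"
      then have "norm (?g (p - Suc i)) = real (i + 2) * ?t (p - Suc i)"
        by (subst norm_mult, subst dist) auto
      also have "\<dots> \<le> real (i + 2) * (s ^ (Suc i * (Suc i + 0)) * ?t p)"
        using s lo i by (intro mult_left_mono norm_theta_term_down) auto
      also have "\<dots> \<le> 0.66 * 0.06 ^ i * ?t p"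
        unfolding mult.assoc[symmetric] using s
        by (intro mult_right_mono square_weight_le) auto
      finally show "norm (?g (p - Suc i)) \<le> 0.66 * ?t p * 0.06 ^ i"
        by (simp add: mult_ac)
    qed auto
    moreover have "norm (?g p + ?g ?k) = ?t p"
      by simp
    ultimately show False using pos[of p] by simp
  qed
qed

theorem theorem1p1:
  fixes q :: complex
  assumes "norm q \<le> 0.108"
  shows "\<not> spectral_value q"
proof
  assume "spectral_value q"
  then obtain a where q1: "norm q < 1" and mz: "multiple_zero (partial_theta q) a"
    by (auto simp: spectral_value_def)
  note sums0 = multiple_zero_partial_theta_sums[OF q1 mz]
  define s where "s = sqrt (norm q)"
  have s: "0 \<le> s" "norm q = s\<^sup>2"
    by (auto simp: s_def)
  \<comment> \<open>This is where 0.108 enters: \<open>0.33\<^sup>2 = 0.1089\<close>.\<close>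
  have s33: "s \<le> 0.33"
    unfolding s_def using assms by (intro real_le_lsqrt) (auto simp: power2_eq_square)
  show False
  proof (cases "norm q * norm a \<le> s")
    case True
    then show False
      using no_zero_if_first_ratio_small[OF s(1) s33 s(2)] sums0(1) by blast
  next
    case False
    then have "a \<noteq> 0" "q \<noteq> 0"
      using s(1) by auto
    then have "s > 0"
      by (simp add: s_def)
    define P where "P = (\<lambda>n. norm q ^ n * norm a \<le> s)"
    have "(\<lambda>n. norm q ^ n * norm a) \<longlonglongrightarrow> 0 * norm a"
      using q1 by (intro tendsto_intros LIMSEQ_realpow_zero) auto
    then have "eventually (\<lambda>n. norm q ^ n * norm a < s) sequentially"
      using \<open>s > 0\<close> by (auto simp: order_tendsto_iff)
    \<comment> \<open>The search starts at index 2 because \<rho> 1 already exceeds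
      \<open>s\<close>. Minimality of \<open>p\<close> gives \<rho> (p + 1) > \<open>s\<close>; for
      \<open>p = 0\<close> the case assumption does.\<close>
    then have "\<exists>n. P (n + 2)"
      unfolding P_def eventually_sequentially by (meson le_add1 less_imp_le)
    then obtain p where p: "P (p + 2)" "\<And>n. n < p \<Longrightarrow> \<not> P (n + 2)"
      using exists_least_iff[of "\<lambda>n. P (n + 2)"] by blast
    have "\<not> P (Suc p)"
      using p(2)[of "p - 1"] False by (cases p) (auto simp: P_def)
    with p(1) show False
      using \<open>s > 0\<close> s33 s(2) \<open>a \<noteq> 0\<close> sums0(2)
      by (intro not_multiple_zero_between[of s q a p]) (auto simp: P_def)
  qed
qed

end
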